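(* Let $(E,\|\cdot\|)$ be a normed space over $\mathbb{K}=\mathbb{R}$ or $\mathbb{C}$ with $E\neq\{0\}$, let $a,b\in\mathbb{R}$, $b\neq 0$, and let $Y\in E$. Then the equation \[ (1+ae^{-\frac{\|X\|}{b}})X=Y \] in the unknown $X$ has in $E$ (a) a unique solution if $a\geq 0$ and $b<0$; (b) a unique solution if $a\leq -1$ and $b<0$; (c) the set of solutions $\{0\}\cup\{X\in E \mid \|X\|=b\ln(|a|)\}$ if $-1<a<0$, $b<0$ and $Y=0$; (d) exactly three solutions if $-1<a<0$, $b<0$ and $0<\|Y\|<(1+ae^{W_{0}(-e/a)-1})\,b\,(1-W_{0}(-e/a))$; (e) exactly two solutions if $-1<a<0$, $b<0$ and $\|Y\|=(1+ae^{W_{0}(-e/a)-1})\,b\,(1-W_{0}(-e/a))$; (f) a unique solution if $-1<a<0$, $b<0$ and $\|Y\|>(1+ae^{W_{0}(-e/a)-1})\,b\,(1-W_{0}(-e/a))$; (g) a unique solution if $0\leq a\leq e^{2}$ and $b>0$; (h) a unique solution if $a>e^{2}$, $b>0$ and either $\|Y\|<(1+ae^{W_{-1}(-e/a)-1})\,b\,(1-W_{-1}(-e/a))$ or $\|Y\|>(1+ae^{W_{0}(-e/a)-1})\,b\,(1-W_{0}(-e/a))$; (i) exactly two solutions if $a>e^{2}$, $b>0$ and either $\|Y\|=(1+ae^{W_{-1}(-e/a)-1})\,b\,(1-W_{-1}(-e/a))$ or $\|Y\|=(1+ae^{W_{0}(-e/a)-1})\,b\,(1-W_{0}(-e/a))$;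 (j) exactly three solutions if $a>e^{2}$, $b>0$ and $(1+ae^{W_{-1}(-e/a)-1})\,b\,(1-W_{-1}(-e/a))<\|Y\|<(1+ae^{W_{0}(-e/a)-1})\,b\,(1-W_{0}(-e/a))$; (k) a unique solution if $-1\leq a<0$ and $b>0$; (l) the set of solutions $\{0\}\cup\{X\in E \mid \|X\|=b\ln(|a|)\}$ if $a<-1$, $b>0$ and $Y=0$; (m) exactly three solutions if $a<-1$, $b>0$ and $0<\|Y\|<-(1+ae^{W_{0}(-e/a)-1})\,b\,(1-W_{0}(-e/a))$; (n) exactly two solutions if $a<-1$, $b>0$ and $\|Y\|=-(1+ae^{W_{0}(-e/a)-1})\,b\,(1-W_{0}(-e/a))$; (o) a unique solution if $a<-1$, $b>0$ and $\|Y\|>-(1+ae^{W_{0}(-e/a)-1})\,b\,(1-W_{0}(-e/a))$.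
   Context: $W_{0}\colon[-e^{-1},\infty)\to[-1,\infty)$ denotes the upper branch and $W_{-1}\colon[-e^{-1},0)\to(-\infty,-1]$ the lower branch of the (real) Lambert W function. That is, $W_0$ is the inverse of the bijection $[-1,\infty)\to[-e^{-1},\infty)$, $x\mapsto xe^{x}$, and $W_{-1}$ is the inverse of the bijection $(-\infty,-1]\to[-e^{-1},0)$, $x\mapsto xe^{x}$. In the claim, $e$ is Euler's number and $\ln$ the natural logarithm. *)

theory Defs
  imports Complex_Main
begin

text \<open>
  A normed space whose scalar field is the type \<open>'k\<close>. The type class
  \<^class>\<open>real_normed_vector\<close> only provides real scalars, so the scalar field is made explicit
  here. Both \<^typ>\<open>real\<close> and \<^typ>\<open>complex\<close> are instances of \<^class>\<open>real_normed_field\<close>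
  (and, by the theorem of Gelfand and Mazur, up to isometric isomorphism the only ones).
\<close>

locale normed_vector_space = vector_space scale
  for scale :: "'k::real_normed_field \<Rightarrow> 'e::ab_group_add \<Rightarrow> 'e" +
  fixes nrm :: "'e \<Rightarrow> real"
  assumes nrm_eq_zero: "nrm x = 0 \<longleftrightarrow> x = 0"
    and nrm_triangle: "nrm (x + y) \<le> nrm x + nrm y"
    and nrm_scale: "nrm (scale c x) = norm c * nrm x"

lemma normed_vector_space_scaleR:
  "normed_vector_space scaleR (norm :: 'a::real_normed_vector \<Rightarrow> real)"
  by unfold_locales (auto simp: algebra_simps norm_triangle_ineq)

lemma normed_vector_space_complex:
  "normed_vector_space ((*) :: complex \<Rightarrow> complex \<Rightarrow> complex) cmod"
  by unfold_locales (auto simp: algebra_simps norm_mult norm_triangle_ineq)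

text \<open>
  The real branches of the Lambert function; they are meaningful only on \<open>[- 1 / e, \<infinity>)\<close> and
  \<open>[- 1 / e, 0)\<close> respectively, and unspecified elsewhere.
\<close>

definition Lambert_W0 :: "real \<Rightarrow> real" where
  "Lambert_W0 = the_inv_into {-1..} (\<lambda>x. x * exp x)"

definition Lambert_Wm1 :: "real \<Rightarrow> real" where
  "Lambert_Wm1 = the_inv_into {..-1} (\<lambda>x. x * exp x)"

definition solutions ::
  "('k::real_normed_field \<Rightarrow> 'e::ab_group_add \<Rightarrow> 'e) \<Rightarrow> ('e \<Rightarrow> real) \<Rightarrow> real \<Rightarrow> real \<Rightarrow> 'e \<Rightarrow> 'e set" where
  "solutions scale nrm a b Y = {X. scale (of_real (1 + a * exp (- (nrm X / b)))) X = Y}"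

end

theory Submission
  imports Defs "HOL-Real_Asymp.Real_Asymp"
begin

text \<open>
  Put \<open>g r = (1 + a * exp (- (r / b))) * r\<close>. Every solution \<open>X\<close> satisfies \<open>\<bar>g (nrm X)\<bar> = nrm Y\<close>; if
  \<open>Y \<noteq> 0\<close>, then \<open>X\<close> is the multiple of \<open>Y\<close> by a scalar that depends only on \<open>nrm X\<close>, so that
  \<^term>\<open>nrm\<close> maps the solutions bijectively onto the roots \<open>r \<ge> 0\<close> of \<open>\<bar>g r\<bar> = nrm Y\<close>.

  With \<open>v = 1 - r / b\<close> one has \<open>g' r = 1 + (a / exp 1) * (v * exp v)\<close>, so the critical points of \<open>g\<close>
  are the numbers \<open>b * (1 - w)\<close> with \<open>w * exp w = - exp 1 / a\<close>, where \<open>w\<close> is a value of one of the two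
  Lambert branches. Hence \<open>\<bar>g\<bar>\<close> either increases on \<open>[0, \<infinity>)\<close> or is N-shaped, i.e. it increases up to
  some \<open>p\<close>, decreases up to some \<open>q\<close>, and increases to infinity afterwards. For \<open>a > exp 1 ^ 2\<close> both
  \<open>p\<close> and \<open>q\<close> are critical points of \<open>g\<close>; in the other N-shaped cases \<open>p\<close> is the only one, and
  \<open>q = b * ln \<bar>a\<bar>\<close> is the positive zero of \<open>g\<close>, where \<open>\<bar>g\<bar>\<close> has a kink.
\<close>

subsection \<open>Roots of functions with an N-shaped graph\<close>

text \<open>The image of a connected set is an interval, which gives existence; injectivity gives
  uniqueness. The points \<open>u\<close> and \<open>v\<close> come in no fixed order, so increasing
  and decreasing branches are both covered.\<close>

lemma ex1_on_connected:
  fixes h :: "real \<Rightarrow> real"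
  assumes "connected S" "continuous_on S h" "inj_on h S"
    and "u \<in> S" "v \<in> S" "h u \<le> y" "y \<le> h v"
  shows "\<exists>!x. x \<in> S \<and> h x = y"
proof -
  have "y \<in> h ` S"
    using connectedD_interval[OF connected_continuous_image[OF assms(2,1)]] assms(4-7) by blast
  then show ?thesis
    using \<open>inj_on h S\<close> by (auto dest: inj_onD)
qed

lemma ex1_strict_mono_at_top:
  fixes h :: "real \<Rightarrow> real"
  assumes "continuous_on {l..} h" "strict_mono_on {l..} h" "filterlim h at_top at_top" "h l \<le> y"
  shows "\<exists>!r. l \<le> r \<and> h r = y"
proof -
  have "\<forall>\<^sub>F r in at_top. y \<le> h r"
    using assms(3) by (simp add: filterlim_at_top)
  then obtain v where "l \<le> v" "y \<le> h v"
    unfolding eventually_at_top_linorder by (meson linear order_trans)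
  then show ?thesis
    using ex1_on_connected[of "{l..}" h l v y] assms strict_mono_on_imp_inj_on[of "{l..}" h] by simp
qed

text \<open>Each of the three monotone branches carries at most one root, and comparing
  \<open>y\<close> with \<open>h p\<close> and \<open>h q\<close> decides which of them do.
  Neighbouring branches share a turning point, so at the levels \<open>h p\<close> and
  \<open>h q\<close> two of the three roots coincide.\<close>

lemma
  fixes h :: "real \<Rightarrow> real"
  assumes cont: "continuous_on {l..} h"
    and pq: "l \<le> p" "p < q"
    and mono: "strict_mono_on {l..p} h" "strict_antimono_on {p..q} h" "strict_mono_on {q..} h"
    and lim: "filterlim h at_top at_top"
    and y: "h l \<le> y"
  shows ex1_N_shaped: "y < h q \<or> h p < y \<Longrightarrow> \<exists>!r. l \<le> r \<and> h r = y"
    and card2_N_shaped: "y = h q \<or> y = h p \<Longrightarrow> card {r. l \<le> r \<and> h r = y} = 2"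
    and card3_N_shaped: "h q < y \<Longrightarrow> y < h p \<Longrightarrow> card {r. l \<le> r \<and> h r = y} = 3"
proof -
  have m1: "h r < h s" if "l \<le> r" "r < s" "s \<le> p" for r s
    using that mono(1) by (auto simp: monotone_on_def)
  have m2: "h s < h r" if "p \<le> r" "r < s" "s \<le> q" for r s
    using that mono(2) by (auto simp: monotone_on_def)
  have m3: "h r < h s" if "q \<le> r" "r < s" for r s
    using that mono(3) by (auto simp: monotone_on_def)
  have inj: "inj_on h {l..p}" "inj_on h {p..q}" "inj_on h {q..}"
    using mono by (auto simp: strict_mono_iff_mono strict_antimono_iff_antimono)
  have C: "continuous_on {l..p} h" "continuous_on {p..q} h" "continuous_on {q..} h"
    by (rule continuous_on_subset[OF cont]; use pq in auto)+
  have root1: "\<exists>r\<in>{l..p}. h r = y" if "y \<le> h p"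
    using ex1_implies_ex[OF ex1_on_connected[OF _ C(1) inj(1), of l p y]] pq y that by auto
  have root2: "\<exists>r\<in>{p..q}. h r = y" if "h q \<le> y" "y \<le> h p"
    using ex1_implies_ex[OF ex1_on_connected[OF _ C(2) inj(2), of q p y]] pq that by auto
  have root3: "\<exists>r\<in>{q..}. h r = y" if "h q \<le> y"
    using ex1_implies_ex[OF ex1_strict_mono_at_top[OF C(3) mono(3) lim that]] by auto
  have hpq: "h q < h p" using m2 pq by auto
  have le1: "h r \<le> h p" if "l \<le> r" "r \<le> p" for r
    using m1[of r p] that by (cases "r = p") auto
  have le2: "h q \<le> h r" "h r \<le> h p" if "p \<le> r" "r \<le> q" for r
    using m2[of r q] m2[of p r] that by (cases "r = q"; cases "r = p"; auto)+
  have le3: "h q \<le> h r" if "q \<le> r" for r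
    using m3[of q r] that by (cases "r = q") auto
  have roots: "{r. l \<le> r \<and> h r = y} = {r \<in> {l..p}. h r = y} \<union> {r \<in> {p..q}. h r = y} \<union> {r \<in> {q..}. h r = y}"
    using pq by auto
  have roots1: "{r \<in> {l..p}. h r = y} = {x}" if "x \<in> {l..p}" "h x = y" for x
    using that inj(1) by (auto dest: inj_onD)
  have roots2: "{r \<in> {p..q}. h r = y} = {x}" if "x \<in> {p..q}" "h x = y" for x
    using that inj(2) by (auto dest: inj_onD)
  have roots3: "{r \<in> {q..}. h r = y} = {x}" if "x \<in> {q..}" "h x = y" for x
    using that inj(3) by (auto dest: inj_onD)
  have none1: "{r \<in> {l..p}. h r = y} = {}" if "h p < y"
    using that le1 by fastforce
  have none2: "{r \<in> {p..q}. h r = y} = {}" if "y < h q \<or> h p < y"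
    using that le2 by fastforce
  have none3: "{r \<in> {q..}. h r = y} = {}" if "y < h q"
    using that le3 by fastforce
  show "\<exists>!r. l \<le> r \<and> h r = y" if "y < h q \<or> h p < y"
  proof -
    from that have "\<exists>x. {r. l \<le> r \<and> h r = y} = {x}"
    proof
      assume *: "y < h q"
      then obtain x where "x \<in> {l..p}" "h x = y" using root1 hpq by auto
      then show ?thesis unfolding roots using roots1[of x] none2 none3 * by blast
    next
      assume *: "h p < y"
      then obtain x where "x \<in> {q..}" "h x = y" using root3 hpq by auto
      then show ?thesis unfolding roots using roots3[of x] none1 none2 * by blast
    qed
    then obtain x where "l \<le> r \<and> h r = y \<longleftrightarrow> r = x" for r by (auto simp: set_eq_iff)
    then show ?thesis by simp
  qed
  show "card {r. l \<le> r \<and> h r = y} = 2" if "y = h q \<or> y = h p"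
    using that
  proof
    assume *: "y = h q"
    then obtain x where x: "x \<in> {l..p}" "h x = y" using root1 hpq by auto
    have "{r. l \<le> r \<and> h r = y} = {x, q}"
      unfolding roots roots1[OF x] using roots2[of q] roots3[of q] pq * by auto
    moreover have "x \<noteq> q" using x pq by auto
    ultimately show ?thesis by simp
  next
    assume *: "y = h p"
    then obtain x where x: "x \<in> {q..}" "h x = y" using root3 hpq by auto
    have "{r. l \<le> r \<and> h r = y} = {p, x}"
      unfolding roots roots3[OF x] using roots1[of p] roots2[of p] pq * by auto
    moreover have "p \<noteq> x" using x pq by auto
    ultimately show ?thesis by simp
  qed
  show "card {r. l \<le> r \<and> h r = y} = 3" if *: "h q < y" "y < h p"
  proof -
    obtain x1 x2 x3 where x: "x1 \<in> {l..p}" "h x1 = y" "x2 \<in> {p..q}" "h x2 = y" "x3 \<in> {q..}" "h x3 = y"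
      using root1 root2 root3 * by (metis less_imp_le)
    have "{r. l \<le> r \<and> h r = y} = {x1, x2, x3}"
      unfolding roots roots1[OF x(1,2)] roots2[OF x(3,4)] roots3[OF x(5,6)] by auto
    \<comment> \<open>The level \<open>y\<close> differs from \<open>h p\<close> and
      \<open>h q\<close>, so \<open>x2\<close> lies strictly inside the middle branch and separates
      \<open>x1\<close> from \<open>x3\<close>.\<close>
    moreover have "x2 \<noteq> p" "x2 \<noteq> q"
      using x(4) * by auto
    then have "x1 < x2" "x2 < x3" using x(1,3,5) by auto
    ultimately show ?thesis by simp
  qed
qed

text \<open>Positivity is asked only strictly between points of \<open>S\<close>, so the derivative
  may vanish at the ends of an interval, where critical points will sit. The exception
  \<open>c\<close> admits a horizontal inflection; monotonicity is then obtained on both sides of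
  \<open>c\<close> and chained.\<close>

lemma strict_mono_on_if_deriv_pos:
  fixes f f' :: "real \<Rightarrow> real"
  assumes der: "\<And>r. (f has_real_derivative f' r) (at r)"
    and pos: "\<And>x y r. x \<in> S \<Longrightarrow> y \<in> S \<Longrightarrow> x < r \<Longrightarrow> r < y \<Longrightarrow> r \<noteq> c \<Longrightarrow> 0 < f' r"
  shows "strict_mono_on S f"
proof (rule monotone_onI)
  fix x y assume xy: "x \<in> S" "y \<in> S" "x < y"
  have incr: "f s < f t" if "s < t" "\<And>r. s < r \<Longrightarrow> r < t \<Longrightarrow> 0 < f' r" for s t
  proof (rule DERIV_pos_imp_increasing_open[OF that(1)])
    show "continuous_on {s..t} f"
      using der by (meson DERIV_atLeastAtMost_imp_continuous_on)
  qed (use der that(2) in blast)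
  show "f x < f y"
  proof (cases "x < c \<and> c < y")
    case True
    then have "f x < f c" "f c < f y"
      using pos xy by (auto intro!: incr)
    then show ?thesis by simp
  next
    case False
    with xy pos[OF xy(1,2)] show ?thesis by (intro incr) auto
  qed
qed

text \<open>Reflecting the part of the graph below the axis turns the descent after \<open>q\<close>
  into an ascent, so the absolute value of \<open>f\<close> is N-shaped with local minimum 0 at
  \<open>q\<close>.\<close>

lemma
  fixes f :: "real \<Rightarrow> real"
  assumes cont: "continuous_on {0..} f"
    and "f 0 = 0" "0 < p" "strict_mono_on {0..p} f" "strict_antimono_on {p..} f"
    and q: "0 < q" "f q = 0"
    and lim: "filterlim (\<lambda>r. \<bar>f r\<bar>) at_top at_top"
    and y: "0 \<le> y"
  shows ex1_abs_hump: "f p < y \<Longrightarrow> \<exists>!r. 0 \<le> r \<and> \<bar>f r\<bar> = y"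
    and card2_abs_hump: "y = f p \<Longrightarrow> card {r. 0 \<le> r \<and> \<bar>f r\<bar> = y} = 2"
    and card3_abs_hump: "0 < y \<Longrightarrow> y < f p \<Longrightarrow> card {r. 0 \<le> r \<and> \<bar>f r\<bar> = y} = 3"
proof -
  have m1: "f r < f s" if "0 \<le> r" "r < s" "s \<le> p" for r s
    using that assms(4) by (auto simp: monotone_on_def)
  have m2: "f s < f r" if "p \<le> r" "r < s" for r s
    using that assms(5) by (auto simp: monotone_on_def)
  \<comment> \<open>Since \<open>f\<close> increases from 0 up to \<open>p\<close>, its positive
    zero \<open>q\<close> can only lie beyond \<open>p\<close>.\<close>
  have pq: "p < q"
    using m1[of 0 q] q assms(2) by force
  have pos: "0 \<le> f r" if "0 \<le> r" "r \<le> q" for r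
    using m1[of 0 r] m2[of r q] assms(2) q that by force
  have neg: "f r \<le> 0" if "q \<le> r" for r
    using m2[of q r] pq q that by force
  note * = ex1_N_shaped[of 0 "\<lambda>r. \<bar>f r\<bar>" p q y] card2_N_shaped[of 0 "\<lambda>r. \<bar>f r\<bar>" p q y]
    card3_N_shaped[of 0 "\<lambda>r. \<bar>f r\<bar>" p q y]
  have "strict_mono_on {0..p} (\<lambda>r. \<bar>f r\<bar>)"
    using m1 pos pq by (auto intro!: monotone_onI)
  moreover have "strict_antimono_on {p..q} (\<lambda>r. \<bar>f r\<bar>)"
    using m2 pos pq assms(3) by (auto intro!: monotone_onI)
  moreover have "strict_mono_on {q..} (\<lambda>r. \<bar>f r\<bar>)"
    using m2 neg pq by (auto intro!: monotone_onI)
  ultimately show "f p < y \<Longrightarrow> \<exists>!r. 0 \<le> r \<and> \<bar>f r\<bar> = y"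
    and "y = f p \<Longrightarrow> card {r. 0 \<le> r \<and> \<bar>f r\<bar> = y} = 2"
    and "0 < y \<Longrightarrow> y < f p \<Longrightarrow> card {r. 0 \<le> r \<and> \<bar>f r\<bar> = y} = 3"
    using * pq pos[of p] assms by (auto intro: continuous_intros)
qed

subsection \<open>The Lambert function\<close>

lemma DERIV_xexp: "((\<lambda>x::real. x * exp x) has_real_derivative (1 + x) * exp x) (at x)"
  by (auto intro!: derivative_eq_intros simp: algebra_simps)

lemma strict_mono_on_xexp: "strict_mono_on {-1..} (\<lambda>x::real. x * exp x)"
  by (rule strict_mono_on_if_deriv_pos[OF DERIV_xexp]) simp

lemma strict_antimono_on_xexp: "strict_antimono_on {..-1} (\<lambda>x::real. x * exp x)"
proof -
  have "strict_mono_on {..-1} (\<lambda>x::real. - (x * exp x))"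
    by (rule strict_mono_on_if_deriv_pos[OF DERIV_minus[OF DERIV_xexp]]) (simp add: mult_neg_pos)
  then show ?thesis
    by (simp add: monotone_on_def)
qed

text \<open>The product \<open>x * exp x\<close> is not monotone on the whole line, but it is
  nonpositive up to 0 and increasing afterwards, so comparison with a positive \<open>w\<close>
  works globally.\<close>

lemma xexp_less: "v * exp v < w * exp w" if "0 < w" "v < w" for v w :: real
proof (cases "v \<le> 0")
  case True
  then have "v * exp v \<le> 0" by (simp add: mult_nonpos_nonneg)
  also have "0 < w * exp w" using that by simp
  finally show ?thesis .
next
  case False
  then show ?thesis using that by (intro mult_strict_mono) auto
qed

lemma xexp_gt_min: "- exp (-1) < v * exp v" if "v \<noteq> -1" for v :: real
  using monotone_onD[OF strict_mono_on_xexp, of "-1" v]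
    monotone_onD[OF strict_antimono_on_xexp, of v "-1"] that
  by (cases v "-1 :: real" rule: linorder_cases) auto

text \<open>The value of \<open>the_inv_into\<close> is meaningful only on the image, so the work
  lies in showing that the branch attains \<open>z\<close>.\<close>

lemma Lambert_W0:
  assumes "- exp (-1) \<le> z"
  shows "-1 \<le> Lambert_W0 z" and "Lambert_W0 z * exp (Lambert_W0 z) = z"
proof -
  have inj: "inj_on (\<lambda>x::real. x * exp x) {-1..}"
    using strict_mono_on_xexp by (rule strict_mono_on_imp_inj_on)
  \<comment> \<open>The upper witness for the intermediate value theorem is \<open>max 0 z\<close>,
    because \<open>u * exp u\<close> is at least \<open>u\<close> for nonnegative
    \<open>u\<close>.\<close>
  have "z \<le> max 0 z * 1" by simp
  also have "\<dots> \<le> max 0 z * exp (max 0 z)" by (intro mult_left_mono) auto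
  finally have "\<exists>!x. x \<in> {-1..} \<and> x * exp x = z"
    using assms inj by (intro ex1_on_connected[of _ _ "-1" "max 0 z"]) (auto intro!: continuous_intros)
  then have "z \<in> (\<lambda>x. x * exp x) ` {-1..}" by blast
  then show "-1 \<le> Lambert_W0 z" "Lambert_W0 z * exp (Lambert_W0 z) = z"
    using the_inv_into_into[OF inj _ order_refl] f_the_inv_into_f[OF inj]
    by (auto simp: Lambert_W0_def)
qed

lemma Lambert_Wm1:
  assumes "- exp (-1) \<le> z" "z < 0"
  shows "Lambert_Wm1 z \<le> -1" and "Lambert_Wm1 z * exp (Lambert_Wm1 z) = z"
proof -
  have inj: "inj_on (\<lambda>x::real. x * exp x) {..-1}"
    using strict_antimono_on_xexp by (simp add: strict_antimono_iff_antimono)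
  \<comment> \<open>On the lower branch the values climb from the minimum at -1 towards 0 as
    \<open>x\<close> tends to minus infinity, so a negative \<open>z\<close> is exceeded far to the
    left.\<close>
  have "((\<lambda>x::real. x * exp x) \<longlongrightarrow> 0) at_bot" by real_asymp
  then have "\<forall>\<^sub>F x in at_bot. z < x * exp x"
    using assms(2) by (rule order_tendstoD)
  then obtain v where "v \<le> -1" "z < v * exp v"
    unfolding eventually_at_bot_linorder by (meson linear order_trans)
  then have "\<exists>!x. x \<in> {..-1} \<and> x * exp x = z"
    using assms inj by (intro ex1_on_connected[of _ _ "-1" v]) (auto intro!: continuous_intros)
  then have "z \<in> (\<lambda>x. x * exp x) ` {..-1}" by blast
  then show "Lambert_Wm1 z \<le> -1" "Lambert_Wm1 z * exp (Lambert_Wm1 z) = z"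
    using the_inv_into_into[OF inj _ order_refl] f_the_inv_into_f[OF inj]
    by (auto simp: Lambert_Wm1_def)
qed

subsection \<open>The radial profile\<close>

definition radial :: "real \<Rightarrow> real \<Rightarrow> real \<Rightarrow> real" where
  "radial a b r = (1 + a * exp (- (r / b))) * r"

lemma radial_0 [simp]: "radial a b 0 = 0"
  by (simp add: radial_def)

lemma radial_Lambert: "b \<noteq> 0 \<Longrightarrow> radial a b (b * (1 - w)) = (1 + a * exp (w - 1)) * b * (1 - w)"
  by (simp add: radial_def)

lemma radial_ln: "a < 0 \<Longrightarrow> b \<noteq> 0 \<Longrightarrow> radial a b (b * ln \<bar>a\<bar>) = 0"
  by (simp add: radial_def exp_minus)

lemma continuous_on_radial [continuous_intros]: "b \<noteq> 0 \<Longrightarrow> continuous_on S (radial a b)"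
  unfolding radial_def by (intro continuous_intros) auto

lemma filterlim_abs_radial:
  assumes "b \<noteq> 0"
  shows "filterlim (\<lambda>r. \<bar>radial a b r\<bar>) at_top at_top"
proof -
  \<comment> \<open>For negative \<open>b\<close> the exponential dominates with the sign of
    \<open>a\<close>, so the asymptotics are settled separately for each sign.\<close>
  consider "b > 0" | "b < 0" "a > 0" | "b < 0" "a = 0" | "b < 0" "a < 0"
    using assms by linarith
  then show ?thesis
    unfolding radial_def by cases (simp_all, real_asymp+)
qed

lemma DERIV_radial:
  assumes "b \<noteq> 0"
  shows "(radial a b has_real_derivative 1 + a / exp 1 * ((1 - r / b) * exp (1 - r / b))) (at r)"
proof -
  have "(radial a b has_real_derivative 1 + a * (1 - r / b) * exp (- (r / b))) (at r)"
    unfolding radial_def using assms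
    by (auto intro!: derivative_eq_intros simp: algebra_simps)
  moreover have "exp (1 - r / b) = exp 1 * exp (- (r / b))"
    by (simp flip: exp_add)
  ultimately show ?thesis by (simp add: mult_ac)
qed

text \<open>An increasing function that starts at 0 is nonnegative, hence equals its absolute value.
  The choice of \<open>f\<close> allows for profiles that decrease from 0.\<close>

lemma strict_mono_on_abs_radial:
  assumes "strict_mono_on {0..} f" "f 0 = 0" "f = radial a b \<or> f = (\<lambda>r. - radial a b r)"
  shows "strict_mono_on {0..} (\<lambda>r. \<bar>radial a b r\<bar>)"
proof -
  have "\<bar>radial a b r\<bar> = f r" if "0 \<le> r" for r
  proof -
    have "0 \<le> f r"
      using monotone_onD[OF assms(1), of 0 r] assms(2) that by (cases "r = 0") auto
    then show ?thesis using assms(3) by auto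
  qed
  then show ?thesis using assms(1) by (simp add: monotone_on_def)
qed

text \<open>In each parameter range \<open>v * exp v\<close> with \<open>v = 1 - r / b\<close> is
  estimated against 0, e or its minimum -1/e; together with the bound on \<open>a\<close> this fixes
  the sign of the derivative.\<close>

lemma ex1_abs_radial:
  assumes "b \<noteq> 0" "0 \<le> y"
    and "(0 \<le> a \<or> a \<le> -1) \<and> b < 0 \<or> (-1 \<le> a \<and> a \<le> exp 1 ^ 2) \<and> 0 < b"
  shows "\<exists>!r. 0 \<le> r \<and> \<bar>radial a b r\<bar> = y"
proof (rule ex1_strict_mono_at_top)
  note der = DERIV_radial[OF \<open>b \<noteq> 0\<close>, of a]
  consider (a) "0 \<le> a" "b < 0" | (b) "a \<le> -1" "b < 0" | (g) "0 < a" "a \<le> exp 1 ^ 2" "0 < b"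
    | (k) "-1 \<le> a" "a \<le> 0" "0 < b"
    using assms(3) by linarith
  then show "strict_mono_on {0..} (\<lambda>r. \<bar>radial a b r\<bar>)"
  proof cases
    case a
    have "strict_mono_on {0..} (radial a b)"
    proof (rule strict_mono_on_if_deriv_pos[OF der])
      fix x y r :: real assume "x \<in> {0..}" "x < r"
      then have "0 \<le> 1 - r / b" using a divide_nonneg_neg[of r b] by simp
      then show "0 < 1 + a / exp 1 * ((1 - r / b) * exp (1 - r / b))"
        using a by (intro add_pos_nonneg mult_nonneg_nonneg) auto
    qed
    then show ?thesis by (rule strict_mono_on_abs_radial) auto
  next
    case b
    have "strict_mono_on {0..} (\<lambda>r. - radial a b r)"
    proof (rule strict_mono_on_if_deriv_pos[OF DERIV_minus[OF der]])
      fix x y r :: real assume "x \<in> {0..}" "x < r"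
      \<comment> \<open>Here \<open>v\<close> exceeds 1, so \<open>v * exp v\<close> exceeds e, and
        the factor \<open>- a\<close>, at least 1, preserves this.\<close>
      then have "r / b < 0" using b by (simp add: divide_pos_neg)
      then have "1 * exp 1 < (1 - r / b) * exp (1 - r / b)"
        by (intro xexp_less) auto
      then have "1 < (1 - r / b) * exp (1 - r / b) / exp 1" by simp
      also have "\<dots> \<le> (- a) * ((1 - r / b) * exp (1 - r / b) / exp 1)"
        using b calculation by (subst mult_le_cancel_right1) linarith
      finally show "0 < - (1 + a / exp 1 * ((1 - r / b) * exp (1 - r / b)))" by simp
    qed
    then show ?thesis by (rule strict_mono_on_abs_radial) auto
  next
    case g
    have "strict_mono_on {0..} (radial a b)"
    \<comment> \<open>At \<open>r = 2 * b\<close> one has \<open>v = -1\<close>, the minimum of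
      \<open>v * exp v\<close>. For \<open>a = exp 1 ^ 2\<close> the derivative vanishes there and
      nowhere else.\<close>
    proof (rule strict_mono_on_if_deriv_pos[OF der, where c = "2 * b"])
      fix x y r :: real assume "r \<noteq> 2 * b"
      then have "1 - r / b \<noteq> -1" using g by (auto simp: field_simps)
      then have "a / exp 1 * (- exp (-1)) < a / exp 1 * ((1 - r / b) * exp (1 - r / b))"
        using g by (intro mult_strict_left_mono xexp_gt_min) auto
      moreover have "-1 \<le> a / exp 1 * (- exp (-1))"
        using g by (simp add: exp_minus field_simps power2_eq_square)
      ultimately show "0 < 1 + a / exp 1 * ((1 - r / b) * exp (1 - r / b))" by linarith
    qed
    then show ?thesis by (rule strict_mono_on_abs_radial) auto
  next
    case k
    have "strict_mono_on {0..} (radial a b)"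
    proof (rule strict_mono_on_if_deriv_pos[OF der])
      fix x y r :: real assume "x \<in> {0..}" "x < r"
      \<comment> \<open>Now \<open>v\<close> is below 1, so \<open>v * exp v\<close> stays below e,
        and the factor \<open>- a\<close> lies between 0 and 1.\<close>
      then have "0 < r / b" using k by simp
      then have *: "(1 - r / b) * exp (1 - r / b) < 1 * exp 1"
        by (intro xexp_less) auto
      have "(- a) * ((1 - r / b) * exp (1 - r / b) / exp 1) < 1"
      proof (cases "a = 0")
        case False
        then have "(- a) * ((1 - r / b) * exp (1 - r / b) / exp 1) < (- a) * 1"
          using k * by (intro mult_strict_left_mono) (auto simp: divide_less_eq)
        then show ?thesis using k by linarith
      qed auto
      then show "0 < 1 + a / exp 1 * ((1 - r / b) * exp (1 - r / b))" by simp
    qed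
    then show ?thesis by (rule strict_mono_on_abs_radial) auto
  qed
qed (use assms in \<open>auto intro!: continuous_intros filterlim_abs_radial\<close>)

text \<open>Replacing the constant 1 by \<open>- (a / exp 1) * (w * exp w)\<close> turns the
  derivative into a difference, whose sign follows from comparing \<open>1 - r / b\<close> with
  \<open>w\<close>.\<close>

lemma DERIV_radial_Lambert:
  assumes "b \<noteq> 0" "a \<noteq> 0" "w * exp w = - exp 1 / a"
  shows "(radial a b has_real_derivative
    a / exp 1 * ((1 - r / b) * exp (1 - r / b) - w * exp w)) (at r)"
proof -
  have "a / exp 1 * (k - w * exp w) = 1 + a / exp 1 * k" for k
    unfolding assms(3) using \<open>a \<noteq> 0\<close> by (simp add: field_simps)
  then show ?thesis
    using DERIV_radial[OF \<open>b \<noteq> 0\<close>, of a r] by simp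
qed

text \<open>As \<open>a\<close> is negative, \<open>- exp 1 / a\<close> is positive and
  \<open>v * exp v\<close> attains it only once, so there is a single critical point. The last two
  claims relate the height \<open>M\<close> to the signed profile and show that levels from
  \<open>M\<close> on are positive, as counting solutions requires.\<close>

lemma
  fixes a b y :: real
  defines "M \<equiv> \<bar>radial a b (b * (1 - Lambert_W0 (- exp 1 / a)))\<bar>"
  assumes ab: "-1 < a \<and> a < 0 \<and> b < 0 \<or> a < -1 \<and> 0 < b" and y: "0 \<le> y"
  shows ex1_abs_radial_hump: "M < y \<Longrightarrow> \<exists>!r. 0 \<le> r \<and> \<bar>radial a b r\<bar> = y"
    and card2_abs_radial_hump: "y = M \<Longrightarrow> card {r. 0 \<le> r \<and> \<bar>radial a b r\<bar> = y} = 2"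
    and card3_abs_radial_hump: "0 < y \<Longrightarrow> y < M \<Longrightarrow> card {r. 0 \<le> r \<and> \<bar>radial a b r\<bar> = y} = 3"
    and abs_radial_hump: "M = - sgn b * radial a b (b * (1 - Lambert_W0 (- exp 1 / a)))"
    and abs_radial_hump_pos: "0 < M"
proof -
  define w where "w = Lambert_W0 (- exp 1 / a)"
  define p where "p = b * (1 - w)"
  \<comment> \<open>The factor \<open>- sgn b\<close> treats both cases at once: it makes the
    profile start with an increase.\<close>
  define f where "f r = - sgn b * radial a b r" for r
  have "a < 0" "b \<noteq> 0" using ab by auto
  then have pos: "0 < - exp 1 / a"
    by (intro divide_neg_neg) auto
  then have w: "w * exp w = - exp 1 / a"
    unfolding w_def by (intro Lambert_W0 order.trans[OF _ less_imp_le[OF pos]]) simp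
  then have "0 < w"
    using pos by (metis exp_gt_zero zero_less_mult_pos2)
  \<comment> \<open>Comparing \<open>- exp 1 / a\<close> with e, the value of
    \<open>x * exp x\<close> at 1, shows that \<open>1 - w\<close> has the sign of
    \<open>b\<close>.\<close>
  have "0 < p"
  proof (cases "b < 0")
    case True
    then have "1 * exp 1 < w * exp w"
      using ab \<open>a < 0\<close> mult_strict_right_mono[of "-1" a "exp 1"] unfolding w by (simp add: field_simps)
    then have "1 < w" using xexp_less[of 1 w]
      by (cases w "1 :: real" rule: linorder_cases) auto
    then show ?thesis using True by (simp add: p_def mult_neg_neg)
  next
    case False
    then have "w * exp w < 1 * exp 1"
      using ab \<open>a < 0\<close> mult_strict_right_mono[of a "-1" "exp 1"] unfolding w by (simp add: field_simps)
    then have "w < 1" using xexp_less[of w 1]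
      by (cases w "1 :: real" rule: linorder_cases) auto
    then show ?thesis using False ab by (simp add: p_def)
  qed
  have der: "(f has_real_derivative - (sgn b * (a / exp 1) * ((1 - r / b) * exp (1 - r / b) - w * exp w))) (at r)" for r
    unfolding f_def using DERIV_cmult[OF DERIV_radial_Lambert[OF \<open>b \<noteq> 0\<close> _ w, of r], of "- sgn b"] \<open>a < 0\<close>
    by (simp add: mult.assoc)
  have mono: "strict_mono_on {0..p} f"
  proof (rule strict_mono_on_if_deriv_pos[OF der])
    fix x y r assume "y \<in> {0..p}" "r < y"
    then have "r < p" by simp
    show "0 < - (sgn b * (a / exp 1) * ((1 - r / b) * exp (1 - r / b) - w * exp w))"
    proof (cases "b < 0")
      case True
      then have "1 - r / b < w" using \<open>r < p\<close> by (simp add: p_def field_simps)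
      with xexp_less[OF \<open>0 < w\<close> this] show ?thesis
        using True \<open>a < 0\<close> by (simp add: zero_less_mult_iff mult_less_0_iff)
    next
      case False
      then have "w < 1 - r / b" using \<open>r < p\<close> ab by (simp add: p_def field_simps)
      then have "w * exp w < (1 - r / b) * exp (1 - r / b)"
        using \<open>0 < w\<close> by (intro xexp_less) auto
      then show ?thesis
        using False ab by (simp add: divide_neg_pos mult_neg_pos)
    qed
  qed
  have anti: "strict_antimono_on {p..} f"
  proof -
    have "strict_mono_on {p..} (\<lambda>r. - f r)"
    proof (rule strict_mono_on_if_deriv_pos[OF DERIV_minus[OF der]])
      fix x y r assume "x \<in> {p..}" "x < r"
      then have "p < r" by simp
      show "0 < - (- (sgn b * (a / exp 1) * ((1 - r / b) * exp (1 - r / b) - w * exp w)))"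
      proof (cases "b < 0")
        case True
        then have "w < 1 - r / b" using \<open>p < r\<close> by (simp add: p_def field_simps)
        then have "w * exp w < (1 - r / b) * exp (1 - r / b)"
          using \<open>0 < w\<close> by (intro xexp_less) auto
        then show ?thesis
          using True \<open>a < 0\<close> by (simp add: divide_neg_pos mult_neg_pos)
      next
        case False
        then have "1 - r / b < w" using \<open>p < r\<close> ab by (simp add: p_def field_simps)
        with xexp_less[OF \<open>0 < w\<close> this] show ?thesis
          using False ab \<open>a < 0\<close> by (simp add: zero_less_mult_iff mult_less_0_iff)
      qed
    qed
    then show ?thesis by (simp add: monotone_on_def)
  qed
  have abs_f: "\<bar>f r\<bar> = \<bar>radial a b r\<bar>" for r
    using \<open>b \<noteq> 0\<close> by (simp add: f_def abs_mult sgn_if)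
  have q: "0 < b * ln \<bar>a\<bar>" "f (b * ln \<bar>a\<bar>) = 0"
    using ab radial_ln[OF \<open>a < 0\<close> \<open>b \<noteq> 0\<close>] by (auto simp: f_def intro: mult_neg_neg)
  have f0: "f 0 = 0" by (simp add: f_def)
  have "f 0 < f p"
    using monotone_onD[OF mono, of 0 p] \<open>0 < p\<close> by simp
  then have M: "M = f p"
    using abs_f[of p] f0 by (simp add: M_def p_def w_def)
  with \<open>f 0 < f p\<close> f0 show "0 < M" by simp
  from M show "M = - sgn b * radial a b (b * (1 - Lambert_W0 (- exp 1 / a)))"
    by (simp add: f_def p_def w_def)
  have cont: "continuous_on {0..} f"
    unfolding f_def using \<open>b \<noteq> 0\<close> by (intro continuous_intros)
  have lim: "filterlim (\<lambda>r. \<bar>f r\<bar>) at_top at_top"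
    using filterlim_abs_radial[OF \<open>b \<noteq> 0\<close>] by (simp add: abs_f)
  note hump = cont f0 \<open>0 < p\<close> mono anti q lim y
  show "M < y \<Longrightarrow> \<exists>!r. 0 \<le> r \<and> \<bar>radial a b r\<bar> = y"
    and "y = M \<Longrightarrow> card {r. 0 \<le> r \<and> \<bar>radial a b r\<bar> = y} = 2"
    and "0 < y \<Longrightarrow> y < M \<Longrightarrow> card {r. 0 \<le> r \<and> \<bar>radial a b r\<bar> = y} = 3"
    using ex1_abs_hump[OF hump] card2_abs_hump[OF hump] card3_abs_hump[OF hump] M
    unfolding abs_f by simp_all
qed

text \<open>The bound on \<open>a\<close> puts \<open>- exp 1 / a\<close> strictly between -1/e and
  0, where both Lambert branches have values, so there are two critical points. Positivity of
  \<open>m\<close> and \<open>M\<close> later ensures that \<open>Y\<close> is nonzero when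
  solutions are counted.\<close>

lemma
  fixes a b y :: real
  defines "M \<equiv> radial a b (b * (1 - Lambert_W0 (- exp 1 / a)))"
    and "m \<equiv> radial a b (b * (1 - Lambert_Wm1 (- exp 1 / a)))"
  assumes a: "exp 1 ^ 2 < a" and b: "0 < b" and y: "0 \<le> y"
  shows ex1_abs_radial_large: "y < m \<or> M < y \<Longrightarrow> \<exists>!r. 0 \<le> r \<and> \<bar>radial a b r\<bar> = y"
    and card2_abs_radial_large: "y = m \<or> y = M \<Longrightarrow> card {r. 0 \<le> r \<and> \<bar>radial a b r\<bar> = y} = 2"
    and card3_abs_radial_large: "m < y \<Longrightarrow> y < M \<Longrightarrow> card {r. 0 \<le> r \<and> \<bar>radial a b r\<bar> = y} = 3"
    and radial_large_pos: "0 < m" "0 < M"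
proof -
  define z where "z = - exp 1 / a"
  define v where "v = Lambert_W0 z"
  define w where "w = Lambert_Wm1 z"
  \<comment> \<open>The map from \<open>r\<close> to \<open>1 - r / b\<close> reverses the order, so
    the upper branch gives the left turning point and the lower branch the right one.\<close>
  define p where "p = b * (1 - v)"
  define q where "q = b * (1 - w)"
  have "0 < a" using a by (meson less_trans zero_less_power exp_gt_zero)
  have z: "- exp (-1) < z" "z < 0"
    using a \<open>0 < a\<close> by (auto simp: z_def exp_minus field_simps power2_eq_square)
  have v: "-1 \<le> v" "v * exp v = z" and w: "w \<le> -1" "w * exp w = z"
    using z Lambert_W0[of z] Lambert_Wm1[of z] by (auto simp: v_def w_def)
  have "v < 0" using v(2) z by (metis exp_gt_zero mult_less_0_iff less_asym)
  \<comment> \<open>The branches meet only at -1, which would force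
    \<open>z = - exp (-1)\<close>.\<close>
  have vw: "w < v" using v w z by (cases "w = v") (auto simp: less_le)
  have "0 < p" "p < q" using b vw \<open>v < 0\<close> by (auto simp: p_def q_def)
  have der: "(radial a b has_real_derivative a / exp 1 * ((1 - r / b) * exp (1 - r / b) - z)) (at r)" for r
    using DERIV_radial_Lambert[of b a v r] v(2) \<open>0 < a\<close> b by (simp add: z_def)
  have gt: "z < u * exp u" if "v < u \<or> u < w" for u
    using that monotone_onD[OF strict_mono_on_xexp, of v u]
      monotone_onD[OF strict_antimono_on_xexp, of u w] v w by auto
  have less: "u * exp u < z" if "w < u" "u < v" for u
    using that monotone_onD[OF strict_mono_on_xexp, of u v]
      monotone_onD[OF strict_antimono_on_xexp, of w u] v w by (cases "u \<le> -1") auto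
  have pos: "\<bar>radial a b r\<bar> = radial a b r" if "0 \<le> r" for r
    using that \<open>0 < a\<close> by (simp add: radial_def)
  have pq: "\<bar>radial a b p\<bar> = M" "\<bar>radial a b q\<bar> = m"
    using pos \<open>0 < p\<close> \<open>p < q\<close> by (auto simp: M_def m_def p_def q_def v_def w_def z_def)
  show "0 < m" "0 < M"
    using pq \<open>0 < p\<close> \<open>p < q\<close> \<open>0 < a\<close>
    by (auto simp: radial_def intro!: mult_pos_pos add_pos_pos)
  have mono: "strict_mono_on {0..p} (radial a b)"
  proof (rule strict_mono_on_if_deriv_pos[OF der])
    fix x y r assume "y \<in> {0..p}" "r < y"
    then have "v < 1 - r / b" using b by (simp add: p_def field_simps)
    with gt show "0 < a / exp 1 * ((1 - r / b) * exp (1 - r / b) - z)"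
      using \<open>0 < a\<close> by simp
  qed
  have mono': "strict_mono_on {q..} (radial a b)"
  proof (rule strict_mono_on_if_deriv_pos[OF der])
    fix x y r assume "x \<in> {q..}" "x < r"
    then have "1 - r / b < w" using b by (simp add: q_def field_simps)
    with gt show "0 < a / exp 1 * ((1 - r / b) * exp (1 - r / b) - z)"
      using \<open>0 < a\<close> by simp
  qed
  have anti: "strict_mono_on {p..q} (\<lambda>r. - radial a b r)"
  proof (rule strict_mono_on_if_deriv_pos[OF DERIV_minus[OF der]])
    fix x y r assume "x \<in> {p..q}" "y \<in> {p..q}" "x < r" "r < y"
    then have "1 - r / b < v" "w < 1 - r / b" using b by (simp_all add: p_def q_def field_simps)
    with less show "0 < - (a / exp 1 * ((1 - r / b) * exp (1 - r / b) - z))"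
      using \<open>0 < a\<close> unfolding neg_0_less_iff_less by (intro mult_pos_neg) auto
  qed
  have N: "continuous_on {0..} (\<lambda>r. \<bar>radial a b r\<bar>)" "0 \<le> p" "p < q"
    "strict_mono_on {0..p} (\<lambda>r. \<bar>radial a b r\<bar>)"
    "strict_antimono_on {p..q} (\<lambda>r. \<bar>radial a b r\<bar>)"
    "strict_mono_on {q..} (\<lambda>r. \<bar>radial a b r\<bar>)"
    "filterlim (\<lambda>r. \<bar>radial a b r\<bar>) at_top at_top" "\<bar>radial a b 0\<bar> \<le> y"
    using mono mono' anti pos \<open>0 < p\<close> \<open>p < q\<close> b y
    by (auto simp: monotone_on_def intro!: continuous_intros filterlim_abs_radial)
  show "y < m \<or> M < y \<Longrightarrow> \<exists>!r. 0 \<le> r \<and> \<bar>radial a b r\<bar> = y"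
    and "y = m \<or> y = M \<Longrightarrow> card {r. 0 \<le> r \<and> \<bar>radial a b r\<bar> = y} = 2"
    and "m < y \<Longrightarrow> y < M \<Longrightarrow> card {r. 0 \<le> r \<and> \<bar>radial a b r\<bar> = y} = 3"
    using ex1_N_shaped[OF N] card2_N_shaped[OF N] card3_N_shaped[OF N] unfolding pq by auto
qed

subsection \<open>Solutions\<close>

context normed_vector_space
begin

lemma nrm_minus: "nrm (- x) = nrm x"
  using nrm_scale[of "-1" x] by (simp add: scale_minus_left)

text \<open>Nonnegativity is not among the axioms; the triangle inequality for \<open>x\<close> and
  \<open>- x\<close> bounds 0 by twice the norm.\<close>

lemma nrm_nonneg: "0 \<le> nrm x"
  using nrm_triangle[of x "- x"] nrm_eq_zero[of 0] by (simp add: nrm_minus)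

lemma nrm_solution:
  assumes "X \<in> solutions scale nrm a b Y"
  shows "\<bar>radial a b (nrm X)\<bar> = nrm Y"
  using assms nrm_scale[of "of_real (1 + a * exp (- (nrm X / b)))" X] nrm_nonneg[of X]
  by (simp add: solutions_def radial_def abs_mult flip: of_real_add)

lemma bij_betw_nrm_solutions:
  assumes "Y \<noteq> 0"
  shows "bij_betw nrm (solutions scale nrm a b Y) {r. 0 \<le> r \<and> \<bar>radial a b r\<bar> = nrm Y}"
proof (rule bij_betwI')
  fix X Z assume XZ: "X \<in> solutions scale nrm a b Y" "Z \<in> solutions scale nrm a b Y"
  show "nrm X = nrm Z \<longleftrightarrow> X = Z"
  proof
    assume "nrm X = nrm Z"
    define c :: 'k where "c = of_real (1 + a * exp (- (nrm X / b)))"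
    have "scale c X = Y" "scale c Z = Y"
      using XZ \<open>nrm X = nrm Z\<close> by (auto simp: solutions_def c_def)
    \<comment> \<open>Equal norms give the same scalar \<open>c\<close>, and \<open>c\<close> can be
      cancelled because \<open>Y\<close> is nonzero.\<close>
    moreover from this have "c \<noteq> 0" using assms by auto
    ultimately show "X = Z" by (metis scale_left_imp_eq)
  qed simp
next
  fix X assume "X \<in> solutions scale nrm a b Y"
  then show "nrm X \<in> {r. 0 \<le> r \<and> \<bar>radial a b r\<bar> = nrm Y}"
    by (simp add: nrm_nonneg nrm_solution)
next
  fix r assume "r \<in> {r. 0 \<le> r \<and> \<bar>radial a b r\<bar> = nrm Y}"
  then have r: "0 \<le> r" "\<bar>radial a b r\<bar> = nrm Y" by auto
  define c where "c = 1 + a * exp (- (r / b))"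
  have c: "\<bar>c\<bar> * r = nrm Y" using r by (simp add: radial_def c_def abs_mult)
  then have "c \<noteq> 0" using assms nrm_eq_zero[of Y] by auto
  \<comment> \<open>The only candidate for a solution of norm \<open>r\<close> comes from dividing
    \<open>Y\<close> by the scalar that \<open>r\<close> prescribes.\<close>
  define X where "X = scale (of_real (inverse c)) Y"
  have "nrm X = r"
    using c[symmetric] \<open>c \<noteq> 0\<close> by (simp add: X_def nrm_scale norm_inverse)
  moreover have "scale (of_real c) X = Y"
    using \<open>c \<noteq> 0\<close> by (simp add: X_def flip: of_real_mult)
  ultimately have "X \<in> solutions scale nrm a b Y"
    by (simp add: solutions_def c_def)
  then show "\<exists>X\<in>solutions scale nrm a b Y. r = nrm X"
    using \<open>nrm X = r\<close> by blast
qed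

lemma card_solutions:
  assumes "0 < nrm Y"
  shows "card (solutions scale nrm a b Y) = card {r. 0 \<le> r \<and> \<bar>radial a b r\<bar> = nrm Y}"
  using assms nrm_eq_zero[of Y] by (intro bij_betw_same_card[OF bij_betw_nrm_solutions]) auto

lemma ex1_solution:
  assumes "\<exists>!r. 0 \<le> r \<and> \<bar>radial a b r\<bar> = nrm Y"
  shows "\<exists>!X. X \<in> solutions scale nrm a b Y"
proof (cases "Y = 0")
  case True
  have "X = 0" if "X \<in> solutions scale nrm a b Y" for X
  proof -
    have "nrm X = 0"
      using nrm_nonneg[of X] nrm_solution[OF that] assms True nrm_eq_zero[of Y]
      by (metis abs_zero order_refl radial_0)
    then show ?thesis by (simp add: nrm_eq_zero)
  qed
  moreover have "0 \<in> solutions scale nrm a b Y"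
    using True by (simp add: solutions_def)
  ultimately show ?thesis by blast
next
  case False
  from assms obtain r where r: "{r. 0 \<le> r \<and> \<bar>radial a b r\<bar> = nrm Y} = {r}"
    by (auto simp: set_eq_iff)
  obtain X where "X \<in> solutions scale nrm a b Y"
    using bij_betwE[OF bij_betw_inv_into[OF bij_betw_nrm_solutions[OF False, of a b]]] r by blast
  moreover have "X = Z" if "X \<in> solutions scale nrm a b Y" "Z \<in> solutions scale nrm a b Y" for X Z
    using bij_betw_nrm_solutions[OF False, of a b] that unfolding r
    by (metis bij_betw_def bij_betwE inj_onD singletonD)
  ultimately show ?thesis by blast
qed

text \<open>A multiple of \<open>X\<close> vanishes only if \<open>X\<close> or the scalar does, and
  for negative \<open>a\<close> the scalar vanishes at exactly one real \<open>r\<close>.\<close>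

lemma solutions_0:
  assumes "a < 0" "b \<noteq> 0"
  shows "solutions scale nrm a b 0 = {0} \<union> {X. nrm X = b * ln \<bar>a\<bar>}"
proof -
  have "1 + a * exp (- (r / b)) = 0 \<longleftrightarrow> r = b * ln \<bar>a\<bar>" for r
  proof -
    have "1 + a * exp (- (r / b)) = 0 \<longleftrightarrow> exp (r / b) = \<bar>a\<bar>"
      using assms by (auto simp: exp_minus field_simps)
    also have "\<dots> \<longleftrightarrow> r / b = ln \<bar>a\<bar>"
      using assms by (metis abs_of_neg exp_ln ln_exp neg_0_less_iff_less)
    also have "\<dots> \<longleftrightarrow> r = b * ln \<bar>a\<bar>"
      using assms by (auto simp: field_simps)
    finally show ?thesis .
  qed
  then show ?thesis
    by (auto simp: solutions_def simp del: of_real_add)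
qed

end

section \<open>The fifteen cases\<close>

theorem theorem2p3:
  fixes scale :: "'k::real_normed_field \<Rightarrow> 'e::ab_group_add \<Rightarrow> 'e"
    and nrm :: "'e \<Rightarrow> real"
    and a b :: real
    and Y :: 'e
  assumes "normed_vector_space scale nrm"
    and "(UNIV :: 'e set) \<noteq> {0}"
    and "b \<noteq> 0"
  shows
   "(a \<ge> 0 \<and> b < 0
      \<longrightarrow> (\<exists>!X. X \<in> solutions scale nrm a b Y)) \<and>
    (a \<le> -1 \<and> b < 0
      \<longrightarrow> (\<exists>!X. X \<in> solutions scale nrm a b Y)) \<and>
    (-1 < a \<and> a < 0 \<and> b < 0 \<and> Y = 0
      \<longrightarrow> solutions scale nrm a b Y = {0} \<union> {X. nrm X = b * ln \<bar>a\<bar>}) \<and>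
    (-1 < a \<and> a < 0 \<and> b < 0 \<and> 0 < nrm Y \<and>
      nrm Y < (1 + a * exp (Lambert_W0 (- exp 1 / a) - 1)) * b * (1 - Lambert_W0 (- exp 1 / a))
      \<longrightarrow> card (solutions scale nrm a b Y) = 3) \<and>
    (-1 < a \<and> a < 0 \<and> b < 0 \<and>
      nrm Y = (1 + a * exp (Lambert_W0 (- exp 1 / a) - 1)) * b * (1 - Lambert_W0 (- exp 1 / a))
      \<longrightarrow> card (solutions scale nrm a b Y) = 2) \<and>
    (-1 < a \<and> a < 0 \<and> b < 0 \<and>
      nrm Y > (1 + a * exp (Lambert_W0 (- exp 1 / a) - 1)) * b * (1 - Lambert_W0 (- exp 1 / a))
      \<longrightarrow> (\<exists>!X. X \<in> solutions scale nrm a b Y)) \<and>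
    (0 \<le> a \<and> a \<le> exp 1 ^ 2 \<and> b > 0
      \<longrightarrow> (\<exists>!X. X \<in> solutions scale nrm a b Y)) \<and>
    (a > exp 1 ^ 2 \<and> b > 0 \<and>
      (nrm Y < (1 + a * exp (Lambert_Wm1 (- exp 1 / a) - 1)) * b * (1 - Lambert_Wm1 (- exp 1 / a)) \<or>
       nrm Y > (1 + a * exp (Lambert_W0 (- exp 1 / a) - 1)) * b * (1 - Lambert_W0 (- exp 1 / a)))
      \<longrightarrow> (\<exists>!X. X \<in> solutions scale nrm a b Y)) \<and>
    (a > exp 1 ^ 2 \<and> b > 0 \<and>
      (nrm Y = (1 + a * exp (Lambert_Wm1 (- exp 1 / a) - 1)) * b * (1 - Lambert_Wm1 (- exp 1 / a)) \<or>
       nrm Y = (1 + a * exp (Lambert_W0 (- exp 1 / a) - 1)) * b * (1 - Lambert_W0 (- exp 1 / a)))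
      \<longrightarrow> card (solutions scale nrm a b Y) = 2) \<and>
    (a > exp 1 ^ 2 \<and> b > 0 \<and>
      (1 + a * exp (Lambert_Wm1 (- exp 1 / a) - 1)) * b * (1 - Lambert_Wm1 (- exp 1 / a)) < nrm Y \<and>
      nrm Y < (1 + a * exp (Lambert_W0 (- exp 1 / a) - 1)) * b * (1 - Lambert_W0 (- exp 1 / a))
      \<longrightarrow> card (solutions scale nrm a b Y) = 3) \<and>
    (-1 \<le> a \<and> a < 0 \<and> b > 0
      \<longrightarrow> (\<exists>!X. X \<in> solutions scale nrm a b Y)) \<and>
    (a < -1 \<and> b > 0 \<and> Y = 0
      \<longrightarrow> solutions scale nrm a b Y = {0} \<union> {X. nrm X = b * ln \<bar>a\<bar>}) \<and>
    (a < -1 \<and> b > 0 \<and> 0 < nrm Y \<and>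
      nrm Y < - ((1 + a * exp (Lambert_W0 (- exp 1 / a) - 1)) * b * (1 - Lambert_W0 (- exp 1 / a)))
      \<longrightarrow> card (solutions scale nrm a b Y) = 3) \<and>
    (a < -1 \<and> b > 0 \<and>
      nrm Y = - ((1 + a * exp (Lambert_W0 (- exp 1 / a) - 1)) * b * (1 - Lambert_W0 (- exp 1 / a)))
      \<longrightarrow> card (solutions scale nrm a b Y) = 2) \<and>
    (a < -1 \<and> b > 0 \<and>
      nrm Y > - ((1 + a * exp (Lambert_W0 (- exp 1 / a) - 1)) * b * (1 - Lambert_W0 (- exp 1 / a)))
      \<longrightarrow> (\<exists>!X. X \<in> solutions scale nrm a b Y))"
proof -
  interpret normed_vector_space scale nrm by fact
  note b = \<open>b \<noteq> 0\<close>
  have Y: "0 \<le> nrm Y" by (rule nrm_nonneg)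
  have unique: "\<exists>!X. X \<in> solutions scale nrm a b Y"
    if "(0 \<le> a \<or> a \<le> -1) \<and> b < 0 \<or> (-1 \<le> a \<and> a \<le> exp 1 ^ 2) \<and> 0 < b"
    using ex1_abs_radial[OF b Y that] by (rule ex1_solution)
  define M m where "M = radial a b (b * (1 - Lambert_W0 (- exp 1 / a)))"
    and "m = radial a b (b * (1 - Lambert_Wm1 (- exp 1 / a)))"
  \<comment> \<open>For negative \<open>b\<close> the profile is positive at its critical point, so
    \<open>M\<close> is the height of the hump.\<close>
  have neg: "M = nrm Y \<Longrightarrow> card (solutions scale nrm a b Y) = 2"
    "nrm Y < M \<Longrightarrow> 0 < nrm Y \<Longrightarrow> card (solutions scale nrm a b Y) = 3"
    "M < nrm Y \<Longrightarrow> \<exists>!X. X \<in> solutions scale nrm a b Y" if "-1 < a" "a < 0" "b < 0"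
  proof -
    have ab: "-1 < a \<and> a < 0 \<and> b < 0 \<or> a < -1 \<and> 0 < b" using that by simp
    have M: "\<bar>M\<bar> = M" "0 < M"
      using abs_radial_hump[OF ab Y] abs_radial_hump_pos[OF ab Y] that by (auto simp: M_def)
    show "M = nrm Y \<Longrightarrow> card (solutions scale nrm a b Y) = 2"
      "nrm Y < M \<Longrightarrow> 0 < nrm Y \<Longrightarrow> card (solutions scale nrm a b Y) = 3"
      "M < nrm Y \<Longrightarrow> \<exists>!X. X \<in> solutions scale nrm a b Y"
      using ex1_abs_radial_hump[OF ab Y, folded M_def] card2_abs_radial_hump[OF ab Y, folded M_def]
        card3_abs_radial_hump[OF ab Y, folded M_def] M
      by (auto intro!: ex1_solution simp: card_solutions)
  qed
  \<comment> \<open>For positive \<open>b\<close> and \<open>a < -1\<close> the profile is negative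
    there, so the height is \<open>- M\<close>.\<close>
  have pos: "- M = nrm Y \<Longrightarrow> card (solutions scale nrm a b Y) = 2"
    "nrm Y < - M \<Longrightarrow> 0 < nrm Y \<Longrightarrow> card (solutions scale nrm a b Y) = 3"
    "- M < nrm Y \<Longrightarrow> \<exists>!X. X \<in> solutions scale nrm a b Y" if "a < -1" "0 < b"
  proof -
    have ab: "-1 < a \<and> a < 0 \<and> b < 0 \<or> a < -1 \<and> 0 < b" using that by simp
    have M: "\<bar>M\<bar> = - M" "0 < - M"
      using abs_radial_hump[OF ab Y] abs_radial_hump_pos[OF ab Y] that by (auto simp: M_def)
    show "- M = nrm Y \<Longrightarrow> card (solutions scale nrm a b Y) = 2"
      "nrm Y < - M \<Longrightarrow> 0 < nrm Y \<Longrightarrow> card (solutions scale nrm a b Y) = 3"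
      "- M < nrm Y \<Longrightarrow> \<exists>!X. X \<in> solutions scale nrm a b Y"
      using ex1_abs_radial_hump[OF ab Y, folded M_def] card2_abs_radial_hump[OF ab Y, folded M_def]
        card3_abs_radial_hump[OF ab Y, folded M_def] M
      by (auto intro!: ex1_solution simp: card_solutions)
  qed
  have large: "nrm Y < m \<or> M < nrm Y \<Longrightarrow> \<exists>!X. X \<in> solutions scale nrm a b Y"
    "nrm Y = m \<or> nrm Y = M \<Longrightarrow> card (solutions scale nrm a b Y) = 2"
    "m < nrm Y \<Longrightarrow> nrm Y < M \<Longrightarrow> card (solutions scale nrm a b Y) = 3"
    if "exp 1 ^ 2 < a" "0 < b"
    using ex1_abs_radial_large[OF that Y] card2_abs_radial_large[OF that Y]
      card3_abs_radial_large[OF that Y] radial_large_pos[OF that Y]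
    unfolding M_def[symmetric] m_def[symmetric]
    by (auto intro!: ex1_solution simp: card_solutions)
  show ?thesis
    \<comment> \<open>The thresholds of the statement are recognised as values of the profile at its
      critical points.\<close>
    unfolding radial_Lambert[OF b, symmetric] M_def[symmetric] m_def[symmetric]
  proof (intro conjI impI, goal_cases)
    case 1
    then show ?case by (intro unique) auto
  next
    case 2
    then show ?case by (intro unique) auto
  next
    case 3
    then show ?case by (auto simp: solutions_0[OF _ b])
  next
    case 4
    then show ?case by (intro neg) auto
  next
    case 5
    then show ?case by (intro neg) auto
  next
    case 6
    then show ?case by (intro neg) auto
  next
    case 7
    then show ?case by (intro unique) auto
  next
    case 8
    then show ?case by (intro large) auto
  next
    case 9
    then show ?case by (intro large) auto
  next
    case 10
    then show ?case by (intro large) auto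
  next
    case 11
    then show ?case by (intro unique) (auto intro: order.trans[of a 0])
  next
    case 12
    then show ?case by (auto simp: solutions_0[OF _ b])
  next
    case 13
    then show ?case by (intro pos) auto
  next
    case 14
    then show ?case by (intro pos) auto
  next
    case 15
    then show ?case by (intro pos) auto
  qed
qed

end
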